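(* Let $(X,d_X)$ be an $n$-point metric space and let $\epsilon\in(0,1]$. Then there is a uniform distribution $\mathcal{D}$ over $O(n\log n/\epsilon^2)$ clan embeddings $(f,\chi)$ of $X$ into ultrametrics, each with multiplicative distortion $O(\frac{\log n}{\epsilon})$, such that for every point $x\in X$, $\mathbb{E}_{(f,\chi)\sim\mathcal{D}}[|f(x)|]\le 1+\epsilon$. In addition, for every $k\in\mathbb{N}$, there is a uniform distribution $\mathcal{D}$ over $O(n^{1+\frac{2}{k}}\log n)$ clan embeddings $(f,\chi)$ of $X$ into ultrametrics, each with multiplicative distortion $16k$, such that for every point $x\in X$, $\mathbb{E}_{(f,\chi)\sim\mathcal{D}}[|f(x)|]=O(n^{\frac1k})$.
   Context: An ultrametric is a metric space $(Y,d)$ with $d(x,z)\le\max\{d(x,y),d(y,z)\}$ for all $x,y,z$. A one-to-many embedding $f:X\to 2^Y$ between metric spaces $(X,d_X)$ and $(Y,d_Y)$ maps each $x\in X$ to a non-empty set $f(x)\subseteq Y$ (its clan; elements are copies of $x$), with the sets $\{f(x)\}_{x\in X}$ pairwise disjoint; it is dominating if $d_X(x,y)\le\min_{x'\in f(x),y'\in f(y)}d_Y(x',y')$ for all $x,y$. A clan embedding is a pair $(f,\chi)$ where $f:X\to 2^Y$ is a dominating one-to-many embedding and $\chi:X\to Y$ satisfies $\chi(x)\in f(x)$ for all $x$ (the chief of $x$). A clan embedding has multiplicative distortion $t$ if for all $x,y\in X$, $\min_{y'\in f(y)}d_Y(y',\chi(x))\le t\cdot d_X(x,y)$. *)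

theory Defs
  imports "HOL-Probability.Probability"
begin

locale Ultrametric_space = Metric_space +
  assumes ultrametric: "\<lbrakk>x \<in> M; y \<in> M; z \<in> M\<rbrakk> \<Longrightarrow> d x z \<le> max (d x y) (d y z)"

text \<open>Clans are required to be finite: this makes the minima over clans below genuine minima
  (\<open>Min\<close> is unspecified on infinite sets) and \<open>card\<close> the true clan size.\<close>

definition one_to_many_embedding :: "'a set \<Rightarrow> 'b set \<Rightarrow> ('a \<Rightarrow> 'b set) \<Rightarrow> bool" where
  "one_to_many_embedding X Y f \<longleftrightarrow>
     (\<forall>x\<in>X. f x \<noteq> {} \<and> finite (f x) \<and> f x \<subseteq> Y) \<and> disjoint_family_on f X"

definition dominating ::
  "'a set \<Rightarrow> ('a \<Rightarrow> 'a \<Rightarrow> real) \<Rightarrow> ('b \<Rightarrow> 'b \<Rightarrow> real) \<Rightarrow> ('a \<Rightarrow> 'b set) \<Rightarrow> bool" where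
  "dominating X dX dY f \<longleftrightarrow>
     (\<forall>x\<in>X. \<forall>y\<in>X. dX x y \<le> Min ((\<lambda>(x', y'). dY x' y') ` (f x \<times> f y)))"

definition clan_embedding ::
  "'a set \<Rightarrow> ('a \<Rightarrow> 'a \<Rightarrow> real) \<Rightarrow> 'b set \<Rightarrow> ('b \<Rightarrow> 'b \<Rightarrow> real)
    \<Rightarrow> ('a \<Rightarrow> 'b set) \<Rightarrow> ('a \<Rightarrow> 'b) \<Rightarrow> bool" where
  "clan_embedding X dX Y dY f chief \<longleftrightarrow>
     one_to_many_embedding X Y f \<and> dominating X dX dY f \<and> (\<forall>x\<in>X. chief x \<in> f x)"

definition clan_distortion ::
  "'a set \<Rightarrow> ('a \<Rightarrow> 'a \<Rightarrow> real) \<Rightarrow> ('b \<Rightarrow> 'b \<Rightarrow> real)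
    \<Rightarrow> ('a \<Rightarrow> 'b set) \<Rightarrow> ('a \<Rightarrow> 'b) \<Rightarrow> real \<Rightarrow> bool" where
  "clan_distortion X dX dY f chief t \<longleftrightarrow>
     (\<forall>x\<in>X. \<forall>y\<in>X. Min ((\<lambda>y'. dY y' (chief x)) ` f y) \<le> t * dX x y)"

text \<open>A clan embedding into a space that may vary is packaged as \<open>(Y, dY, f, chief)\<close>. As clans are
  finite and \<open>X\<close> will be finite, only finitely many points of \<open>Y\<close> matter, so fixing \<open>nat\<close> as
  the type of target points loses no generality.\<close>

type_synonym 'a target_clan_embedding =
  "nat set \<times> (nat \<Rightarrow> nat \<Rightarrow> real) \<times> ('a \<Rightarrow> nat set) \<times> ('a \<Rightarrow> nat)"

definition ultrametric_clan_embeddings ::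
  "'a set \<Rightarrow> ('a \<Rightarrow> 'a \<Rightarrow> real) \<Rightarrow> real \<Rightarrow> 'a target_clan_embedding set" where
  "ultrametric_clan_embeddings X dX t =
     {(Y, dY, f, chief). Ultrametric_space Y dY \<and> clan_embedding X dX Y dY f chief \<and>
        clan_distortion X dX dY f chief t}"

fun clan_size :: "'a \<Rightarrow> 'a target_clan_embedding \<Rightarrow> real" where
  "clan_size x (Y, dY, f, chief) = real (card (f x))"

text \<open>The asymptotic bounds on the number of embeddings are written \<open>C * max 1 B\<close>. For at least
  two points \<open>B \<ge> 1\<close> in both parts, so this is \<open>C * B\<close>; for a one-point space \<open>B = 0\<close>, while the
  support of a distribution cannot be empty.\<close>

end

theory Submission
  imports Defs
begin

text \<open>Fix a weight \<open>\<mu> \<ge> 1\<close>. Ball growing builds one ultrametric clan embedding of distortion \<open>16k\<close>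
  with \<open>\<Sum> \<mu> x * card (f x) \<le> \<mu>(X) * G powr (1/k)\<close>, where \<open>G\<close> bounds the weight of the balls of
  radius \<open>diam/4\<close>. Let \<open>v\<close> be the centre of a heaviest ball of radius \<open>diam/8\<close>. Grow the ball at \<open>v\<close>
  from radius \<open>diam/8\<close> to \<open>diam/4\<close> in \<open>k\<close> steps; at some step the weight increases by a factor at most
  \<open>(G/G') powr (1/k)\<close>, where \<open>G'\<close> is the weight of the initial ball. Duplicate the points of this
  annulus, recurse on the outer ball \<open>P\<close> and on the complement \<open>Q\<close> of the inner one, and join the two
  ultrametrics at height \<open>diam\<close>. As \<open>P\<close> has diameter at most \<open>diam/2\<close>, the choice of \<open>v\<close> makes \<open>G'\<close> a
  valid bound for \<open>P\<close>, which pays for the duplicates.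

  Applied to \<open>\<mu> = n w / W + 1\<close>, of total weight \<open>2n\<close>, this gives for every weight \<open>w\<close> of total \<open>W\<close> an
  embedding whose \<open>w\<close>-average clan size is at most \<open>2 (2n) powr (1/k) - 1\<close> and whose clans have at most
  \<open>(2n) powr (1 + 1/k)\<close> points. The multiplicative weights method turns these responses into a uniform
  distribution on few embeddings that is good for every point.\<close>

section \<open>Ultrametric clan embeddings: membership, relabelling and gluing\<close>

lemma Ultrametric_spaceI:
  assumes "\<And>x y. 0 \<le> d x y" "\<And>x y. d x y = d y x"
    and "\<And>x y. x \<in> M \<Longrightarrow> y \<in> M \<Longrightarrow> d x y = 0 \<longleftrightarrow> x = y"
    and ultra: "\<And>x y z. x \<in> M \<Longrightarrow> y \<in> M \<Longrightarrow> z \<in> M \<Longrightarrow> d x z \<le> max (d x y) (d y z)"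
  shows "Ultrametric_space M d"
proof unfold_locales
  fix x y z assume "x \<in> M" "y \<in> M" "z \<in> M"
  then show "d x z \<le> d x y + d y z"
    using ultra[of x y z] assms(1)[of x y] assms(1)[of y z] by linarith
qed (use assms in auto)

text \<open>Minima over clans become quantifiers, which is sound for finite nonempty clans. On the
  right nonemptiness comes from \<open>\<kappa> x \<in> f x\<close>, so both sides fail as soon as
  some clan is empty or infinite.\<close>

lemma mem_ultrametric_clan_embeddings_iff:
  "(Y, \<rho>, f, \<kappa>) \<in> ultrametric_clan_embeddings X d t \<longleftrightarrow>
     Ultrametric_space Y \<rho> \<and> (\<forall>x\<in>X. finite (f x) \<and> f x \<subseteq> Y \<and> \<kappa> x \<in> f x) \<and>
     disjoint_family_on f X \<and>
     (\<forall>x\<in>X. \<forall>y\<in>X. \<forall>a\<in>f x. \<forall>b\<in>f y. d x y \<le> \<rho> a b) \<and>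
     (\<forall>x\<in>X. \<forall>y\<in>X. \<exists>b\<in>f y. \<rho> b (\<kappa> x) \<le> t * d x y)"
  (is "?L \<longleftrightarrow> ?R")
proof (cases "\<forall>x\<in>X. finite (f x) \<and> f x \<noteq> {}")
  case True
  then have "dominating X d \<rho> f \<longleftrightarrow> (\<forall>x\<in>X. \<forall>y\<in>X. \<forall>a\<in>f x. \<forall>b\<in>f y. d x y \<le> \<rho> a b)"
    unfolding dominating_def by (intro ball_cong refl) (subst Min_ge_iff; auto)
  moreover have "clan_distortion X d \<rho> f \<kappa> t \<longleftrightarrow>
      (\<forall>x\<in>X. \<forall>y\<in>X. \<exists>b\<in>f y. \<rho> b (\<kappa> x) \<le> t * d x y)"
    unfolding clan_distortion_def using True by (intro ball_cong refl) (subst Min_le_iff; auto)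
  ultimately show ?thesis
    using True unfolding ultrametric_clan_embeddings_def clan_embedding_def
      one_to_many_embedding_def by auto
next
  case False
  then have "\<not> ?L"
    unfolding ultrametric_clan_embeddings_def clan_embedding_def one_to_many_embedding_def by auto
  moreover have "\<not> ?R"
    using False by blast
  ultimately show ?thesis by simp
qed

text \<open>The left inverse \<open>g\<close> makes \<open>h\<close> injective and pulls the
  ultrametric back. This serves to give listed embeddings pairwise different target sets.\<close>

lemma relabel_ultrametric_clan_embedding:
  assumes e: "(Y, \<rho>, f, \<kappa>) \<in> ultrametric_clan_embeddings X d t"
    and gh: "\<And>a. g (h a) = a"
  shows "(h ` Y, \<lambda>a b. \<rho> (g a) (g b), \<lambda>x. h ` f x, \<lambda>x. h (\<kappa> x)) \<in> ultrametric_clan_embeddings X d t"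
proof -
  note e' = e[unfolded mem_ultrametric_clan_embeddings_iff]
  interpret Ultrametric_space Y \<rho> using e' by blast
  have inj: "h a = h b \<longleftrightarrow> a = b" for a b by (metis gh)
  have "Ultrametric_space (h ` Y) (\<lambda>a b. \<rho> (g a) (g b))"
  proof (rule Ultrametric_spaceI)
    show "\<rho> (g a) (g b) = \<rho> (g b) (g a)" for a b by (rule commute)
  qed (use ultrametric in \<open>auto simp: gh simp del: max.bounded_iff le_max_iff_disj\<close>)
  moreover have "disjoint_family_on (\<lambda>x. h ` f x) X"
    unfolding disjoint_family_on_def
  proof (intro ballI impI)
    fix x y assume "x \<in> X" "y \<in> X" "x \<noteq> y"
    then have "f x \<inter> f y = {}" using e' by (simp add: disjoint_family_on_def)
    then show "h ` f x \<inter> h ` f y = {}" by (auto simp: inj)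
  qed
  ultimately show ?thesis
    unfolding mem_ultrametric_clan_embeddings_iff using e' by (auto simp: gh)
qed

text \<open>Targets must again be sets of naturals, so a disjoint union is coded by
  \<open>sum_encode\<close>. The cross distance \<open>\<Delta>\<close> is the height of a new root
  joining two trees.\<close>

definition glued_dist ::
  "real \<Rightarrow> (nat \<Rightarrow> nat \<Rightarrow> real) \<Rightarrow> (nat \<Rightarrow> nat \<Rightarrow> real) \<Rightarrow> nat \<Rightarrow> nat \<Rightarrow> real" where
  "glued_dist \<Delta> \<rho>1 \<rho>2 a b = (case (sum_decode a, sum_decode b) of
      (Inl a', Inl b') \<Rightarrow> \<rho>1 a' b' | (Inr a', Inr b') \<Rightarrow> \<rho>2 a' b' | _ \<Rightarrow> \<Delta>)"

lemma glued_dist_simps [simp]: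
  "glued_dist \<Delta> \<rho>1 \<rho>2 (sum_encode (Inl a)) (sum_encode (Inl b)) = \<rho>1 a b"
  "glued_dist \<Delta> \<rho>1 \<rho>2 (sum_encode (Inr a)) (sum_encode (Inr b)) = \<rho>2 a b"
  "glued_dist \<Delta> \<rho>1 \<rho>2 (sum_encode (Inl a)) (sum_encode (Inr b)) = \<Delta>"
  "glued_dist \<Delta> \<rho>1 \<rho>2 (sum_encode (Inr a)) (sum_encode (Inl b)) = \<Delta>"
  by (simp_all add: glued_dist_def)

text \<open>A triple meeting both sides has two cross pairs at distance \<open>\<Delta>\<close>, and
  its third distance is at most \<open>\<Delta>\<close> by \<open>b1\<close> or \<open>b2\<close>.
  So the two largest distances agree.\<close>

lemma Ultrametric_space_glued:
  assumes "Ultrametric_space Y1 \<rho>1" "Ultrametric_space Y2 \<rho>2" "0 < \<Delta>"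
    and b1: "\<And>a b. a \<in> Y1 \<Longrightarrow> b \<in> Y1 \<Longrightarrow> \<rho>1 a b \<le> \<Delta>"
    and b2: "\<And>a b. a \<in> Y2 \<Longrightarrow> b \<in> Y2 \<Longrightarrow> \<rho>2 a b \<le> \<Delta>"
  shows "Ultrametric_space (sum_encode ` (Y1 <+> Y2)) (glued_dist \<Delta> \<rho>1 \<rho>2)"
proof -
  interpret A: Ultrametric_space Y1 \<rho>1 by fact
  interpret B: Ultrametric_space Y2 \<rho>2 by fact
  show ?thesis
  proof (rule Ultrametric_spaceI)
    fix x y z
    assume "x \<in> sum_encode ` (Y1 <+> Y2)" "y \<in> sum_encode ` (Y1 <+> Y2)"
      "z \<in> sum_encode ` (Y1 <+> Y2)"
    then show "glued_dist \<Delta> \<rho>1 \<rho>2 x z \<le> max (glued_dist \<Delta> \<rho>1 \<rho>2 x y) (glued_dist \<Delta> \<rho>1 \<rho>2 y z)"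
      using A.ultrametric B.ultrametric by (auto elim!: PlusE simp: b1 b2 simp del: max.bounded_iff le_max_iff_disj)
  next
    fix x y
    show "0 \<le> glued_dist \<Delta> \<rho>1 \<rho>2 x y" "glued_dist \<Delta> \<rho>1 \<rho>2 x y = glued_dist \<Delta> \<rho>1 \<rho>2 y x"
      using \<open>0 < \<Delta>\<close> by (auto simp: glued_dist_def A.commute B.commute split: sum.split)
    assume "x \<in> sum_encode ` (Y1 <+> Y2)" "y \<in> sum_encode ` (Y1 <+> Y2)"
    then show "glued_dist \<Delta> \<rho>1 \<rho>2 x y = 0 \<longleftrightarrow> x = y"
      using \<open>0 < \<Delta>\<close> by (auto elim!: PlusE simp: sum_encode_eq)
  qed
qed

text \<open>\<open>L\<close> consists of the points whose chief is taken from the \<open>P\<close>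
  side. If \<open>y\<close> has a copy on the side of the chief of \<open>x\<close>, the distortion
  is inherited. Otherwise \<open>sepP\<close> or \<open>sepQ\<close> makes even the root distance
  \<open>\<Delta>\<close> affordable.\<close>

lemma glue_ultrametric_clan_embeddings:
  fixes P Q :: "'a set"
  assumes e1: "(Y1, \<rho>1, f1, \<kappa>1) \<in> ultrametric_clan_embeddings P d t"
    and e2: "(Y2, \<rho>2, f2, \<kappa>2) \<in> ultrametric_clan_embeddings Q d t"
    and b1: "\<And>a b. a \<in> Y1 \<Longrightarrow> b \<in> Y1 \<Longrightarrow> \<rho>1 a b \<le> \<Delta>"
    and b2: "\<And>a b. a \<in> Y2 \<Longrightarrow> b \<in> Y2 \<Longrightarrow> \<rho>2 a b \<le> \<Delta>"
    and "0 < \<Delta>" and diam: "\<And>x y. x \<in> P \<union> Q \<Longrightarrow> y \<in> P \<union> Q \<Longrightarrow> d x y \<le> \<Delta>"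
    and L: "L \<subseteq> P" "P - Q \<subseteq> L"
    and sepP: "\<And>x y. x \<in> L \<Longrightarrow> y \<in> Q - P \<Longrightarrow> \<Delta> \<le> t * d x y"
    and sepQ: "\<And>x y. x \<in> Q - L \<Longrightarrow> y \<in> P - Q \<Longrightarrow> \<Delta> \<le> t * d x y"
  obtains Y \<rho> f \<kappa> where "(Y, \<rho>, f, \<kappa>) \<in> ultrametric_clan_embeddings (P \<union> Q) d t"
    and "\<And>a b. a \<in> Y \<Longrightarrow> b \<in> Y \<Longrightarrow> \<rho> a b \<le> \<Delta>"
    and "\<And>x. card (f x) = (if x \<in> P then card (f1 x) else 0) + (if x \<in> Q then card (f2 x) else 0)"
proof -
  note e1' = e1[unfolded mem_ultrametric_clan_embeddings_iff]
  note e2' = e2[unfolded mem_ultrametric_clan_embeddings_iff]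
  \<comment> \<open>Outside \<open>P\<close> and \<open>Q\<close> the maps \<open>f1\<close> and
    \<open>f2\<close> are arbitrary. Cutting them down to the empty set makes the cardinality
    equation valid for every \<open>x\<close>.\<close>
  define F1 where "F1 x = (if x \<in> P then f1 x else {})" for x :: 'a
  define F2 where "F2 x = (if x \<in> Q then f2 x else {})" for x :: 'a
  define Y where "Y = sum_encode ` (Y1 <+> Y2)"
  define \<rho> where "\<rho> = glued_dist \<Delta> \<rho>1 \<rho>2"
  define f where "f x = sum_encode ` (F1 x <+> F2 x)" for x
  define \<kappa> where "\<kappa> x = sum_encode (if x \<in> L then Inl (\<kappa>1 x) else Inr (\<kappa>2 x))" for x
  have fin: "finite (F1 x)" "finite (F2 x)" for x
    using e1' e2' by (auto simp: F1_def F2_def)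
  have um: "Ultrametric_space Y \<rho>"
    unfolding Y_def \<rho>_def
    by (rule Ultrametric_space_glued) (use e1' e2' b1 b2 \<open>0 < \<Delta>\<close> in auto)
  have bd: "\<rho> a b \<le> \<Delta>" if "a \<in> Y" "b \<in> Y" for a b
    using that unfolding Y_def \<rho>_def by (auto elim!: PlusE simp: b1 b2)
  have sub: "finite (f x) \<and> f x \<subseteq> Y \<and> \<kappa> x \<in> f x" if "x \<in> P \<union> Q" for x
  proof -
    have "F1 x \<subseteq> Y1" "F2 x \<subseteq> Y2" using e1' e2' by (auto simp: F1_def F2_def)
    moreover have "\<kappa> x \<in> f x"
      using that L e1' e2' by (auto simp: \<kappa>_def f_def F1_def F2_def)
    ultimately show ?thesis
      using fin[of x] unfolding f_def Y_def by (auto elim!: PlusE)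
  qed
  have dis: "disjoint_family_on f (P \<union> Q)"
    unfolding disjoint_family_on_def
  proof (intro ballI impI)
    fix x y :: 'a assume "x \<noteq> y"
    then have "F1 x \<inter> F1 y = {}" "F2 x \<inter> F2 y = {}"
      using e1' e2' by (auto simp: F1_def F2_def disjoint_family_on_def)
    then show "f x \<inter> f y = {}"
      by (fastforce simp: f_def sum_encode_eq elim!: PlusE)
  qed
  have dom: "d x y \<le> \<rho> a b" if "x \<in> P \<union> Q" "y \<in> P \<union> Q" "a \<in> f x" "b \<in> f y" for x y a b
    using that(3,4) e1' e2' diam[OF that(1,2)] unfolding f_def F1_def F2_def \<rho>_def
    by (auto elim!: PlusE split: if_splits)
  have dist: "\<exists>b\<in>f y. \<rho> b (\<kappa> x) \<le> t * d x y" if xy: "x \<in> P \<union> Q" "y \<in> P \<union> Q" for x y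
  proof -
    consider "x \<in> L" "y \<in> P" | "x \<in> Q - L" "y \<in> Q" | "\<Delta> \<le> t * d x y"
      using xy L sepP sepQ by blast
    then show ?thesis
    proof cases
      case 1
      then obtain b where "b \<in> f1 y" "\<rho>1 b (\<kappa>1 x) \<le> t * d x y" using e1' L by blast
      then show ?thesis
        using 1 by (intro bexI[of _ "sum_encode (Inl b)"]) (auto simp: \<rho>_def \<kappa>_def f_def F1_def)
    next
      case 2
      then obtain b where "b \<in> f2 y" "\<rho>2 b (\<kappa>2 x) \<le> t * d x y" using e2' by blast
      then show ?thesis
        using 2 by (intro bexI[of _ "sum_encode (Inr b)"]) (auto simp: \<rho>_def \<kappa>_def f_def F2_def)
    next
      case 3
      moreover have "\<rho> (\<kappa> y) (\<kappa> x) \<le> \<Delta>" using sub xy by (intro bd) blast+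
      ultimately show ?thesis using sub[OF xy(2)] by force
    qed
  qed
  have "card (f x) = card (F1 x) + card (F2 x)" for x
    unfolding f_def using fin[of x]
    by (subst card_image) (auto simp: card_Plus inj_on_def sum_encode_eq)
  then have "card (f x) = (if x \<in> P then card (f1 x) else 0) + (if x \<in> Q then card (f2 x) else 0)" for x
    by (simp add: F1_def F2_def)
  moreover have "(Y, \<rho>, f, \<kappa>) \<in> ultrametric_clan_embeddings (P \<union> Q) d t"
    unfolding mem_ultrametric_clan_embeddings_iff using um sub dis dom dist by blast
  ultimately show thesis using that bd by blast
qed

section \<open>Ball growing\<close>

text \<open>If each of the \<open>k\<close> steps multiplied by more than
  \<open>(a k / a 0) powr (1 / k)\<close>, the telescoping product would exceed
  \<open>a k / a 0\<close>.\<close>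

lemma exists_small_growth_step:
  fixes a :: "nat \<Rightarrow> real"
  assumes "0 < k" and pos: "\<And>i. 0 < a i"
  shows "\<exists>i<k. a (Suc i) * a 0 powr (1 / real k) \<le> a i * a k powr (1 / real k)"
proof (rule ccontr)
  assume neg: "\<not> ?thesis"
  define s where "s = (a k / a 0) powr (1 / real k)"
  have "s > 0" using pos[of 0] pos[of k] by (simp add: s_def)
  have step: "a i * s < a (Suc i)" if "i < k" for i
  proof -
    have "a i * a k powr (1 / real k) < a (Suc i) * a 0 powr (1 / real k)"
      using neg that by (auto simp: not_le)
    then show ?thesis
      using pos[of 0] pos[of k] by (simp add: s_def powr_divide field_simps)
  qed
  \<comment> \<open>The strict inequality fails for the empty product, so the induction starts after
    one step.\<close>
  have "Suc j \<le> k \<Longrightarrow> a 0 * s ^ Suc j < a (Suc j)" for j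
  proof (induction j)
    case 0
    then show ?case using step[of 0] by simp
  next
    case (Suc j)
    then have "a 0 * s ^ Suc j * s < a (Suc j) * s" using \<open>s > 0\<close> by (intro mult_strict_right_mono) auto
    also have "\<dots> < a (Suc (Suc j))" using Suc step by simp
    finally show ?case by (simp only: power_Suc2 mult.assoc)
  qed
  from this[of "k - 1"] have "a 0 * s ^ k < a k" using \<open>0 < k\<close> by simp
  moreover have "s ^ k = a k / a 0"
    using \<open>0 < k\<close> pos[of 0] pos[of k] \<open>s > 0\<close>
    by (simp add: s_def powr_powr flip: powr_realpow)
  ultimately show False using pos[of 0] by simp
qed

text \<open>\<open>\<Delta>\<close> is an upper bound for the diameter because the recursion knows
  only such a bound for \<open>P\<close>. The bound on \<open>\<rho>\<close> is carried along since
  gluing at height \<open>D\<close> requires it.\<close>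

lemma (in Metric_space) exists_ultrametric_clan_embedding:
  fixes \<mu> :: "'a \<Rightarrow> real" and k :: nat
  assumes "finite X" "X \<noteq> {}" "X \<subseteq> M" "k \<ge> 1" "\<And>x. x \<in> X \<Longrightarrow> 1 \<le> \<mu> x"
    and "\<And>x y. x \<in> X \<Longrightarrow> y \<in> X \<Longrightarrow> d x y \<le> \<Delta>"
    and "\<And>v. v \<in> X \<Longrightarrow> sum \<mu> {x \<in> X. d v x \<le> \<Delta> / 4} \<le> G"
  shows "\<exists>Y \<rho> f \<kappa>. (Y, \<rho>, f, \<kappa>) \<in> ultrametric_clan_embeddings X d (16 * real k) \<and>
           (\<forall>a\<in>Y. \<forall>b\<in>Y. \<rho> a b \<le> \<Delta>) \<and>
           (\<Sum>x\<in>X. \<mu> x * card (f x)) \<le> sum \<mu> X * G powr (1 / real k)"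
  using assms
proof (induction "card X" arbitrary: X \<Delta> G rule: less_induct)
  case less
  note X = less.prems(1-3) and mu = less.prems(5) and ball = less.prems(7)
  show ?case
  proof (cases "card X = 1")
    case True
    then obtain x where X1: "X = {x}" by (auto simp: card_1_singleton_iff)
    have "x \<in> M" using X X1 by auto
    have "0 \<le> \<Delta>" using less.prems(6)[of x x] X1 \<open>x \<in> M\<close> by simp
    \<comment> \<open>The ball at the only point weighs at least 1, hence \<open>1 \<le> G\<close>,
      which pays for the single copy.\<close>
    then have "{y \<in> X. d x y \<le> \<Delta> / 4} = {x}" using X1 \<open>x \<in> M\<close> by auto
    then have "1 \<le> G" using ball[of x] mu[of x] X1 by simp
    then have "1 \<le> G powr (1 / real k)" by (intro ge_one_powr_ge_zero) auto
    then have "(\<Sum>x\<in>X. \<mu> x * card {0::nat}) \<le> sum \<mu> X * G powr (1 / real k)"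
      using mu[of x] X1 by simp
    moreover have "({0}, \<lambda>a b. if a = b then 0 else 1, \<lambda>_. {0}, \<lambda>_. 0)
        \<in> ultrametric_clan_embeddings X d (16 * real k)"
      unfolding mem_ultrametric_clan_embeddings_iff
      using X1 \<open>x \<in> M\<close> by (auto intro!: Ultrametric_spaceI simp: disjoint_family_on_def)
    ultimately show ?thesis
      using \<open>0 \<le> \<Delta>\<close> by (intro exI[of _ "{0}"] exI[of _ "\<lambda>a b. if a = b then 0 else 1"]
          exI[of _ "\<lambda>_. {0}"] exI[of _ "\<lambda>_. 0"]) auto
  next
    case False
    have k: "real k \<ge> 1" "k > 0" using less.prems(4) by auto
    have "card X > 1" using False X by (metis One_nat_def card_gt_0_iff nat_neq_iff less_one)
    then obtain x0 y0 where xy0: "x0 \<in> X" "y0 \<in> X" "x0 \<noteq> y0"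
      using X by (metis card_le_Suc0_iff_eq One_nat_def not_less)
    \<comment> \<open>The true diameter. It is attained at some \<open>x1\<close> and
      \<open>y1\<close>, so \<open>P\<close>, of diameter at most \<open>D / 2\<close>, cannot be
      all of \<open>X\<close>.\<close>
    define D where "D = Max ((\<lambda>(x, y). d x y) ` (X \<times> X))"
    have fin2: "finite ((\<lambda>(x, y). d x y) ` (X \<times> X))" "(\<lambda>(x, y). d x y) ` (X \<times> X) \<noteq> {}"
      using X by auto
    have diam: "d x y \<le> D" if "x \<in> X" "y \<in> X" for x y
      unfolding D_def using that fin2 by (intro Max_ge) auto
    obtain x1 y1 where xy1: "x1 \<in> X" "y1 \<in> X" "d x1 y1 = D"
      using Max_in[OF fin2] unfolding D_def[symmetric] by auto
    have "D > 0" using diam[OF xy0(1,2)] xy0 X mdist_pos_less[of x0 y0] by fastforce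
    have "D \<le> \<Delta>" using less.prems(6) xy1 by force
    have mu0: "0 \<le> \<mu> x" if "x \<in> X" for x using mu[OF that] by simp
    define B where "B v r = {x \<in> X. d v x \<le> r}" for v r
    have B: "finite (B v r)" "B v r \<subseteq> X" for v r using X by (auto simp: B_def)
    have Bmono: "sum \<mu> (B v r) \<le> sum \<mu> (B v s)" if "r \<le> s" for v r s
      using that B mu0 by (intro sum_mono2) (auto simp: B_def)
    have G: "sum \<mu> (B v (D / 4)) \<le> G" if "v \<in> X" for v
      using ball[OF that] Bmono[of "D / 4" "\<Delta> / 4" v] \<open>D \<le> \<Delta>\<close> unfolding B_def by simp
    \<comment> \<open>Minimizing the negated weight selects the heaviest ball of radius
      \<open>D / 8\<close>.\<close>
    define v where "v = arg_min_on (\<lambda>u. - sum \<mu> (B u (D / 8))) X"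
    have v: "v \<in> X" "\<And>u. u \<in> X \<Longrightarrow> sum \<mu> (B u (D / 8)) \<le> sum \<mu> (B v (D / 8))"
      using arg_min_if_finite[of X "\<lambda>u. - sum \<mu> (B u (D / 8))"] X unfolding v_def by (auto simp: not_less)
    \<comment> \<open>The radii from \<open>D / 8\<close> to \<open>D / 4\<close> have spacing
      \<open>D / (8 * k) = 2 * \<delta>\<close>. Half an annulus separates a chief from the points
      absent on its side, so the distortion is \<open>D / \<delta> = 16 * k\<close>.\<close>
    define \<delta> where "\<delta> = D / (16 * real k)"
    define r where "r i = D / 8 + real i * (2 * \<delta>)" for i
    have wpos: "\<delta> > 0" using \<open>D > 0\<close> k by (simp add: \<delta>_def)
    have r: "r 0 = D / 8" "r k = D / 4" "\<And>i. r (Suc i) = r i + 2 * \<delta>"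
      using k by (auto simp: r_def \<delta>_def field_simps)
    have vB: "v \<in> B v s" if "0 \<le> s" for s using v X that by (auto simp: B_def)
    have rpos: "0 \<le> r i" for i using \<open>D > 0\<close> wpos by (simp add: r_def)
    have posB: "0 < sum \<mu> (B v (r i))" for i
      by (rule sum_pos) (use vB[OF rpos[of i]] B mu in \<open>force+\<close>)
    obtain i where i: "i < k"
      and grow: "sum \<mu> (B v (r (Suc i))) * sum \<mu> (B v (r 0)) powr (1 / real k)
          \<le> sum \<mu> (B v (r i)) * sum \<mu> (B v (r k)) powr (1 / real k)"
      using exists_small_growth_step[of k "\<lambda>i. sum \<mu> (B v (r i))"] posB k by blast
    \<comment> \<open>\<open>P\<close> and \<open>Q\<close> overlap in the annulus, whose points get
      copies on both sides. The middle radius decides which side provides the chief.\<close>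
    define P Q L where "P = B v (r (Suc i))" and "Q = X - B v (r i)"
      and "L = B v (r i + \<delta>)"
    have "r (Suc i) \<le> r k"
      unfolding r_def using i wpos by (intro add_left_mono mult_right_mono) auto
    then have rle: "r (Suc i) \<le> D / 4" using r by simp
    have PQ: "P \<union> Q = X" using wpos by (auto simp: P_def Q_def B_def r)
    have sub: "P \<subseteq> X" "Q \<subseteq> X" by (auto simp: P_def Q_def B_def)
    have diamP: "d x y \<le> D / 2" if "x \<in> P" "y \<in> P" for x y
    proof -
      have "x \<in> M" "y \<in> M" "v \<in> M" using that sub X v by auto
      then have "d x y \<le> d v x + d v y" using triangle[of x v y] commute[of x v] by simp
      then show ?thesis using that rle by (auto simp: P_def B_def)
    qed
    then have "\<not> (x1 \<in> P \<and> y1 \<in> P)" using xy1 \<open>D > 0\<close> by force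
    then have "P \<noteq> X" "Q \<noteq> {}" using xy1 PQ by auto
    have "v \<notin> Q" "v \<in> P" using vB rpos by (auto simp: P_def Q_def)
    then have "P \<noteq> {}" "Q \<noteq> X" using v by auto
    have cards: "card P < card X" "card Q < card X"
      using sub \<open>P \<noteq> X\<close> \<open>Q \<noteq> X\<close> X by (auto intro!: psubset_card_mono)
    have fin: "finite P" "finite Q" using sub X(1) by (blast intro: finite_subset)+
    define G' where "G' = sum \<mu> (B v (D / 8))"
    \<comment> \<open>At scale \<open>D / 2\<close> the relevant balls have radius
      \<open>D / 8\<close>, so the choice of \<open>v\<close> bounds their weight by
      \<open>G'\<close>.\<close>
    have ballP: "sum \<mu> {x \<in> P. d u x \<le> D / 2 / 4} \<le> G'" if "u \<in> P" for u
    proof -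
      have "sum \<mu> {x \<in> P. d u x \<le> D / 2 / 4} \<le> sum \<mu> (B u (D / 8))"
        using sub X(1) mu0 by (intro sum_mono2) (auto simp: B_def)
      also have "\<dots> \<le> G'" using that sub v by (auto simp: G'_def)
      finally show ?thesis .
    qed
    have "\<exists>Y \<rho> f \<kappa>. (Y, \<rho>, f, \<kappa>) \<in> ultrametric_clan_embeddings P d (16 * real k) \<and>
        (\<forall>a\<in>Y. \<forall>b\<in>Y. \<rho> a b \<le> D / 2) \<and>
        (\<Sum>x\<in>P. \<mu> x * card (f x)) \<le> sum \<mu> P * G' powr (1 / real k)"
    proof (rule less.hyps[OF cards(1) fin(1) \<open>P \<noteq> {}\<close> _ less.prems(4)])
      show "P \<subseteq> M" using sub X by blast
    qed (use sub(1) mu diamP ballP in blast)+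
    then obtain Y1 \<rho>1 f1 \<kappa>1 where e1: "(Y1, \<rho>1, f1, \<kappa>1) \<in> ultrametric_clan_embeddings P d (16 * real k)"
      "\<forall>a\<in>Y1. \<forall>b\<in>Y1. \<rho>1 a b \<le> D / 2"
      "(\<Sum>x\<in>P. \<mu> x * card (f1 x)) \<le> sum \<mu> P * G' powr (1 / real k)"
      by blast
    \<comment> \<open>For \<open>Q\<close> the scale \<open>D\<close> and the bound \<open>G\<close>
      stay the same. The progress is that \<open>v\<close> is dropped.\<close>
    have ballQ: "sum \<mu> {x \<in> Q. d u x \<le> D / 4} \<le> G" if "u \<in> Q" for u
    proof -
      have "sum \<mu> {x \<in> Q. d u x \<le> D / 4} \<le> sum \<mu> (B u (D / 4))"
        using sub X(1) mu0 by (intro sum_mono2) (auto simp: B_def)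
      also have "\<dots> \<le> G" using that sub G by auto
      finally show ?thesis .
    qed
    have "\<exists>Y \<rho> f \<kappa>. (Y, \<rho>, f, \<kappa>) \<in> ultrametric_clan_embeddings Q d (16 * real k) \<and>
        (\<forall>a\<in>Y. \<forall>b\<in>Y. \<rho> a b \<le> D) \<and>
        (\<Sum>x\<in>Q. \<mu> x * card (f x)) \<le> sum \<mu> Q * G powr (1 / real k)"
    proof (rule less.hyps[OF cards(2) fin(2) \<open>Q \<noteq> {}\<close> _ less.prems(4)])
      show "Q \<subseteq> M" using sub X by blast
    qed (use sub(2) mu diam ballQ in blast)+
    then obtain Y2 \<rho>2 f2 \<kappa>2 where e2: "(Y2, \<rho>2, f2, \<kappa>2) \<in> ultrametric_clan_embeddings Q d (16 * real k)"
      "\<forall>a\<in>Y2. \<forall>b\<in>Y2. \<rho>2 a b \<le> D"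
      "(\<Sum>x\<in>Q. \<mu> x * card (f2 x)) \<le> sum \<mu> Q * G powr (1 / real k)"
      by blast
    \<comment> \<open>By the reverse triangle inequality, distances from \<open>v\<close> differing
      by \<open>\<delta>\<close> force \<open>\<delta> \<le> d x y\<close>.\<close>
    have gap: "D \<le> 16 * real k * d x y" if "x \<in> X" "y \<in> X" "\<delta> \<le> \<bar>d v x - d v y\<bar>" for x y
    proof -
      have "x \<in> M" "y \<in> M" "v \<in> M" using that X v by auto
      then have "\<bar>d v x - d v y\<bar> \<le> d x y"
        using triangle[of v x y] triangle[of v y x] commute[of x y] by linarith
      then have "\<delta> \<le> d x y" using that by linarith
      then show ?thesis using k by (simp add: \<delta>_def field_simps)
    qed
    obtain Y \<rho> f \<kappa> where e: "(Y, \<rho>, f, \<kappa>) \<in> ultrametric_clan_embeddings (P \<union> Q) d (16 * real k)"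
      and bd: "\<And>a b. a \<in> Y \<Longrightarrow> b \<in> Y \<Longrightarrow> \<rho> a b \<le> D"
      and card_f: "\<And>x. card (f x) = (if x \<in> P then card (f1 x) else 0) + (if x \<in> Q then card (f2 x) else 0)"
    proof (rule glue_ultrametric_clan_embeddings[OF e1(1) e2(1), of D L])
      show "\<rho>1 a b \<le> D" if "a \<in> Y1" "b \<in> Y1" for a b using that e1(2) \<open>D > 0\<close> by force
      show "D \<le> 16 * real k * d x y" if "x \<in> L" "y \<in> Q - P" for x y
        using that sub by (intro gap) (auto simp: L_def P_def Q_def B_def r)
      show "D \<le> 16 * real k * d x y" if "x \<in> Q - L" "y \<in> P - Q" for x y
        using that sub by (intro gap) (auto simp: L_def P_def Q_def B_def r)
      show "L \<subseteq> P" "P - Q \<subseteq> L"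
        using wpos by (auto simp: L_def P_def Q_def B_def r)
    qed (use e2(2) \<open>D > 0\<close> diam in \<open>unfold PQ, blast+\<close>)
    have "(\<Sum>x\<in>X. \<mu> x * card (f x)) =
        (\<Sum>x\<in>X. if x \<in> P then \<mu> x * card (f1 x) else 0) + (\<Sum>x\<in>X. if x \<in> Q then \<mu> x * card (f2 x) else 0)"
      unfolding sum.distrib[symmetric] by (intro sum.cong) (auto simp: card_f algebra_simps)
    also have "\<dots> = (\<Sum>x\<in>P. \<mu> x * card (f1 x)) + (\<Sum>x\<in>Q. \<mu> x * card (f2 x))"
      using sub X by (simp add: sum.If_cases Int_absorb1)
    also have "\<dots> \<le> sum \<mu> P * G' powr (1 / real k) + sum \<mu> Q * G powr (1 / real k)"
      using e1(3) e2(3) by linarith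
    \<comment> \<open>The growth inequality trades \<open>P\<close> with \<open>G'\<close> for the
      inner ball with \<open>G\<close>. The inner ball and \<open>Q\<close> partition
      \<open>X\<close>, so their weights then add up to that of \<open>X\<close>.\<close>
    also have "\<dots> \<le> sum \<mu> (B v (r i)) * G powr (1 / real k) + sum \<mu> Q * G powr (1 / real k)"
    proof -
      have "sum \<mu> P * G' powr (1 / real k) \<le> sum \<mu> (B v (r i)) * sum \<mu> (B v (r k)) powr (1 / real k)"
        using grow by (simp add: P_def G'_def r)
      also have "\<dots> \<le> sum \<mu> (B v (r i)) * G powr (1 / real k)"
        using posB[of i] posB[of k] G[OF v(1)] r by (intro mult_left_mono powr_mono2) auto
      finally show ?thesis by simp
    qed
    also have "\<dots> = sum \<mu> X * G powr (1 / real k)"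
      unfolding Q_def sum.subset_diff[OF B(2) X(1), of \<mu> v "r i"] by (simp only: distrib_right add.commute)
    finally have "(\<Sum>x\<in>X. \<mu> x * card (f x)) \<le> sum \<mu> X * G powr (1 / real k)" .
    moreover have "\<forall>a\<in>Y. \<forall>b\<in>Y. \<rho> a b \<le> \<Delta>" using bd \<open>D \<le> \<Delta>\<close> order_trans by blast
    ultimately show ?thesis using e unfolding PQ by blast
  qed
qed

section \<open>Multiplicative weights\<close>

text \<open>Each round plays a response to weights exponential in the accumulated costs. As the
  response is good on average, the total weight grows by a factor of at most
  \<open>exp (q * A)\<close>, where \<open>q = (exp \<eta> - 1) / K\<close>. The weight of one point
  is at most the total, and logarithms give the bound. The sequence is chosen before
  \<open>T\<close>.\<close>

lemma multiplicative_weights: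
  fixes c :: "'e \<Rightarrow> 'a \<Rightarrow> real" and A K \<eta> :: real
  assumes "finite X" "X \<noteq> {}" "0 < K" "0 < \<eta>"
    and width: "\<And>e x. e \<in> E \<Longrightarrow> x \<in> X \<Longrightarrow> 0 \<le> c e x \<and> c e x \<le> K"
    and response: "\<And>w. (\<And>x. x \<in> X \<Longrightarrow> 0 < w x) \<Longrightarrow> \<exists>e\<in>E. (\<Sum>x\<in>X. w x * c e x) \<le> A * sum w X"
  obtains e :: "nat \<Rightarrow> 'e" where "\<And>i. e i \<in> E"
    and "\<And>T x. x \<in> X \<Longrightarrow>
      \<eta> * (\<Sum>i<T. c (e i) x) \<le> K * ln (card X) + real T * A * (exp \<eta> - 1)"
proof -
  define W where "W g x = exp (\<eta> / K * g x)" for g :: "'a \<Rightarrow> real" and x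
  define best where "best g = (SOME e. e \<in> E \<and> (\<Sum>x\<in>X. W g x * c e x) \<le> A * sum (W g) X)" for g
  have best: "best g \<in> E \<and> (\<Sum>x\<in>X. W g x * c (best g) x) \<le> A * sum (W g) X" for g
    unfolding best_def by (rule someI_ex) (use response[of "W g"] in \<open>auto simp: W_def\<close>)
  \<comment> \<open>\<open>g i x\<close> is the cost accumulated at \<open>x\<close> before round
    \<open>i\<close>. The recursion runs on whole functions since a response depends on all
    points.\<close>
  define g where "g = rec_nat (\<lambda>_. 0) (\<lambda>_ g x. g x + c (best g) x)"
  have g: "g 0 = (\<lambda>_. 0)" "\<And>i. g (Suc i) = (\<lambda>x. g i x + c (best (g i)) x)"
    by (simp_all add: g_def)
  define e where "e i = best (g i)" for i
  have g_sum: "g T x = (\<Sum>i<T. c (e i) x)" for T x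
    by (induction T) (simp_all add: g e_def)
  define q where "q = (exp \<eta> - 1) / K"
  have "0 < q" using assms by (simp add: q_def)
  text \<open>The chord of \<open>exp\<close> over \<open>[0, \<eta>]\<close> lies above its graph.\<close>
  have chord: "exp (\<eta> / K * s) \<le> 1 + q * s" if "0 \<le> s" "s \<le> K" for s
  proof -
    have "exp ((1 - s / K) *\<^sub>R 0 + (s / K) *\<^sub>R \<eta>) \<le> (1 - s / K) * exp 0 + (s / K) * exp \<eta>"
      using that \<open>0 < K\<close> by (intro convex_onD[OF exp_convex]) auto
    then show ?thesis by (simp add: q_def algebra_simps diff_divide_distrib)
  qed
  have step: "sum (W (g (Suc i))) X \<le> sum (W (g i)) X * exp (q * A)" for i
  proof -
    have "sum (W (g (Suc i))) X = (\<Sum>x\<in>X. W (g i) x * exp (\<eta> / K * c (e i) x))"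
      by (simp add: W_def g e_def distrib_left exp_add)
    also have "\<dots> \<le> (\<Sum>x\<in>X. W (g i) x * (1 + q * c (e i) x))"
      using best width by (intro sum_mono mult_left_mono chord) (auto simp: W_def e_def)
    also have "\<dots> = sum (W (g i)) X + q * (\<Sum>x\<in>X. W (g i) x * c (e i) x)"
      by (simp add: algebra_simps sum.distrib sum_distrib_left)
    also have "\<dots> \<le> sum (W (g i)) X + q * (A * sum (W (g i)) X)"
      using best \<open>0 < q\<close> by (intro add_left_mono mult_left_mono) (auto simp: e_def)
    also have "\<dots> = sum (W (g i)) X * (1 + q * A)" by (simp add: algebra_simps)
    also have "\<dots> \<le> sum (W (g i)) X * exp (q * A)"
      by (intro mult_left_mono exp_ge_add_one_self sum_nonneg) (auto simp: W_def)
    finally show ?thesis .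
  qed
  have potential: "sum (W (g T)) X \<le> card X * exp (q * A * T)" for T
  proof (induction T)
    case 0
    then show ?case by (simp add: W_def g)
  next
    case (Suc T)
    have "sum (W (g (Suc T))) X \<le> card X * exp (q * A * T) * exp (q * A)"
      using step[of T] Suc by (meson exp_ge_zero mult_right_mono order_trans)
    then show ?case by (simp add: algebra_simps exp_add)
  qed
  have "\<eta> * (\<Sum>i<T. c (e i) x) \<le> K * ln (card X) + real T * A * (exp \<eta> - 1)" if "x \<in> X" for T x
  proof -
    have "card X > 0" using assms by (simp add: card_gt_0_iff)
    have "W (g T) x \<le> sum (W (g T)) X"
      using that assms by (intro member_le_sum) (auto simp: W_def)
    then have "exp (\<eta> / K * g T x) \<le> exp (ln (card X) + q * A * T)"
      using potential[of T] \<open>card X > 0\<close> by (simp add: W_def exp_add)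
    then have "\<eta> / K * g T x \<le> ln (card X) + q * A * T" by simp
    then show ?thesis using \<open>0 < K\<close> by (simp add: g_sum q_def field_simps)
  qed
  then show thesis using that[of e] best by (auto simp: e_def)
qed

section \<open>Embeddings balanced for a given weight, and lists of embeddings as sets\<close>

text \<open>\<open>\<mu>\<close> adds the counting measure to \<open>w\<close> rescaled to total
  \<open>n\<close>. The counting part caps every clan by the whole cost \<open>2 * n * q\<close>. It
  also costs at least \<open>n\<close>, and subtracting this yields the factor
  \<open>2 * q - 1\<close>, which tends to 1 with \<open>q\<close>.\<close>

lemma (in Metric_space) exists_balanced_clan_embedding:
  fixes w :: "'a \<Rightarrow> real" and k :: nat
  defines "q \<equiv> (2 * real (card M)) powr (1 / real k)"
  assumes "finite M" "M \<noteq> {}" "k \<ge> 1" and w: "\<And>x. x \<in> M \<Longrightarrow> 0 < w x"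
  shows "\<exists>e \<in> ultrametric_clan_embeddings M d (16 * real k).
           (\<forall>x\<in>M. clan_size x e \<le> 2 * real (card M) * q) \<and>
           (\<Sum>x\<in>M. w x * clan_size x e) \<le> (2 * q - 1) * sum w M"
proof -
  define n where "n = real (card M)"
  define W where "W = sum w M"
  define \<mu> where "\<mu> x = n * w x / W + 1" for x
  have "n > 0" using assms by (simp add: n_def card_gt_0_iff)
  have "W > 0" unfolding W_def using assms by (intro sum_pos) auto
  have mu: "1 \<le> \<mu> x" if "x \<in> M" for x
    using w[OF that] \<open>n > 0\<close> \<open>W > 0\<close> by (simp add: \<mu>_def)
  have total: "sum \<mu> M = 2 * n"
    using \<open>W > 0\<close> by (simp add: \<mu>_def sum.distrib n_def W_def flip: sum_divide_distrib sum_distrib_left)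
  define \<Delta> where "\<Delta> = Max ((\<lambda>(x, y). d x y) ` (M \<times> M))"
  have "d x y \<le> \<Delta>" if "x \<in> M" "y \<in> M" for x y
    unfolding \<Delta>_def using that assms(2) by (intro Max_ge) auto
  \<comment> \<open>Ball weights are bounded by the total weight, hence the base
    \<open>2 * n\<close> in \<open>q\<close>.\<close>
  moreover have "sum \<mu> {x \<in> M. d v x \<le> \<Delta> / 4} \<le> 2 * n" for v
    unfolding total[symmetric] using mu assms(2) by (intro sum_mono2) (auto, fastforce)
  ultimately obtain Y \<rho> f \<kappa> where e: "(Y, \<rho>, f, \<kappa>) \<in> ultrametric_clan_embeddings M d (16 * real k)"
    and S: "(\<Sum>x\<in>M. \<mu> x * card (f x)) \<le> 2 * n * q"
    using exists_ultrametric_clan_embedding[of M k \<mu> \<Delta> "2 * n"] mu assms(2-4)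
    unfolding total q_def n_def[symmetric] by auto
  have one: "1 \<le> card (f x)" if "x \<in> M" for x
    using e that unfolding mem_ultrametric_clan_embeddings_iff
    by (metis One_nat_def Suc_leI card_gt_0_iff empty_iff)
  have "card (f x) \<le> 2 * n * q" if "x \<in> M" for x
  proof -
    have "real (card (f x)) \<le> \<mu> x * card (f x)" using mu[OF that] by (simp add: mult_le_cancel_right1)
    also have "\<dots> \<le> (\<Sum>x\<in>M. \<mu> x * card (f x))"
      using that assms(2) mu by (intro member_le_sum) (auto, smt (verit) mu mult_nonneg_nonneg of_nat_0_le_iff)
    finally show ?thesis using S by linarith
  qed
  moreover have "(\<Sum>x\<in>M. w x * card (f x)) \<le> (2 * q - 1) * W"
  proof -
    have "n \<le> (\<Sum>x\<in>M. real (card (f x)))"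
      using sum_mono[of M "\<lambda>_. 1" "\<lambda>x. real (card (f x))"] one by (simp add: n_def)
    moreover have "(\<Sum>x\<in>M. \<mu> x * card (f x)) =
        n / W * (\<Sum>x\<in>M. w x * card (f x)) + (\<Sum>x\<in>M. real (card (f x)))"
      by (simp add: \<mu>_def distrib_right sum.distrib sum_distrib_left mult.assoc)
    ultimately have "n * (\<Sum>x\<in>M. w x * card (f x)) / W \<le> n * (2 * q - 1)"
      using S by (simp add: algebra_simps)
    then have "n * (\<Sum>x\<in>M. w x * card (f x)) \<le> n * ((2 * q - 1) * W)"
      using \<open>W > 0\<close> by (simp add: pos_divide_le_eq mult.assoc)
    then show ?thesis using \<open>n > 0\<close> by simp
  qed
  ultimately show ?thesis
    using e by (intro bexI[of _ "(Y, \<rho>, f, \<kappa>)"]) (auto simp: n_def W_def)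
qed

text \<open>Tagging the target points with the index turns a list of embeddings with repetitions into a
  set of the same cardinality.\<close>

lemma exists_set_of_clan_embeddings:
  assumes "X \<noteq> {}" and e: "\<And>i. e i \<in> ultrametric_clan_embeddings X d t"
  obtains S where "finite S" "card S = T" "S \<subseteq> ultrametric_clan_embeddings X d t"
    "\<And>x. (\<Sum>s\<in>S. clan_size x s) = (\<Sum>i<T. clan_size x (e i))"
proof -
  define tag :: "nat \<Rightarrow> 'a target_clan_embedding \<Rightarrow> 'a target_clan_embedding" where
    "tag i = (\<lambda>(Y, \<rho>, f, \<kappa>). ((\<lambda>a. prod_encode (i, a)) ` Y,
        \<lambda>a b. \<rho> (snd (prod_decode a)) (snd (prod_decode b)),
        \<lambda>x. (\<lambda>a. prod_encode (i, a)) ` f x, \<lambda>x. prod_encode (i, \<kappa> x)))" for i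
  have mem: "tag i (e i) \<in> ultrametric_clan_embeddings X d t" for i
    using e[of i] relabel_ultrametric_clan_embedding[where g = "\<lambda>a. snd (prod_decode a)"
        and h = "\<lambda>a. prod_encode (i, a)"]
    by (cases "e i") (auto simp: tag_def)
  have size: "clan_size x (tag i s) = clan_size x s" for x i s
    by (cases s) (auto simp: tag_def card_image inj_on_def prod_encode_eq)
  have inj: "inj (\<lambda>i. tag i (e i))"
  proof (rule injI)
    fix i j assume eq: "tag i (e i) = tag j (e j)"
    \<comment> \<open>Target sets contain the chiefs, so they are nonempty, and any tagged point
      reveals its index.\<close>
    have "fst (e i) \<noteq> {}"
      using e[of i] \<open>X \<noteq> {}\<close>
      by (cases "e i") (fastforce simp: mem_ultrametric_clan_embeddings_iff)
    then obtain a where "a \<in> fst (e i)" by blast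
    moreover have fst_tag: "fst (tag l s) = (\<lambda>a. prod_encode (l, a)) ` fst s" for l s
      by (cases s) (simp add: tag_def)
    ultimately have "prod_encode (i, a) \<in> (\<lambda>a. prod_encode (j, a)) ` fst (e j)"
      by (metis eq imageI)
    then show "i = j" by (auto simp: prod_encode_eq)
  qed
  show thesis
  proof (rule that[of "(\<lambda>i. tag i (e i)) ` {..<T}"])
    show "card ((\<lambda>i. tag i (e i)) ` {..<T}) = T"
      using inj by (simp add: card_image inj_on_subset)
    show "(\<Sum>s\<in>(\<lambda>i. tag i (e i)) ` {..<T}. clan_size x s) = (\<Sum>i<T. clan_size x (e i))" for x
      using inj_on_subset[OF inj] by (subst sum.reindex) (auto simp: size)
  qed (use mem in auto)
qed

section \<open>Uniform distributions over clan embeddings\<close>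

lemma exp_le_one_plus_quadratic:
  fixes x :: real
  assumes "0 \<le> x" "x \<le> 1"
  shows "exp x - 1 \<le> x * (1 + x)"
  using exp_bound[OF assms] by (simp add: algebra_simps power2_eq_square)

text \<open>Multiplicative weights with width \<open>2 * n * q\<close> and average
  \<open>2 * q - 1\<close>. Dividing by \<open>\<eta> * T\<close> turns the logarithmic term into
  the first summand, and \<open>exp \<eta> - 1 \<le> \<eta> * (1 + \<eta>)\<close> yields the
  second.\<close>

lemma (in Metric_space) exists_uniform_clan_embeddings:
  fixes k T :: nat and \<eta> :: real
  defines "n \<equiv> real (card M)"
  defines "q \<equiv> (2 * n) powr (1 / real k)"
  assumes "finite M" "M \<noteq> {}" "k \<ge> 1" "T \<ge> 1" "0 < \<eta>" "\<eta> \<le> 1"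
  obtains S where "finite S" "S \<noteq> {}" "card S = T" "S \<subseteq> ultrametric_clan_embeddings M d (16 * real k)"
    and "\<And>x. x \<in> M \<Longrightarrow> measure_pmf.expectation (pmf_of_set S) (clan_size x)
            \<le> 2 * n * q * ln n / (\<eta> * T) + (2 * q - 1) * (1 + \<eta>)"
proof -
  \<comment> \<open>The restriction on clan sizes supplies the width. Balanced responses satisfy
    it.\<close>
  define E where "E = {e \<in> ultrametric_clan_embeddings M d (16 * real k).
      \<forall>x\<in>M. clan_size x e \<le> 2 * n * q}"
  have "n \<ge> 1" using assms(3,4) by (simp add: n_def Suc_le_eq card_gt_0_iff)
  then have "q \<ge> 1" unfolding q_def by (intro ge_one_powr_ge_zero) auto
  have nonneg_size: "0 \<le> clan_size x e" for x and e :: "'a target_clan_embedding"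
    by (cases e) simp
  obtain e where eE: "\<And>i. e i \<in> E"
    and bound: "\<And>T x. x \<in> M \<Longrightarrow> \<eta> * (\<Sum>i<T. clan_size x (e i))
        \<le> 2 * n * q * ln (card M) + real T * (2 * q - 1) * (exp \<eta> - 1)"
  proof (rule multiplicative_weights[of M "2 * n * q" \<eta> E "\<lambda>e x. clan_size x e" "2 * q - 1"])
    show "\<exists>e\<in>E. (\<Sum>x\<in>M. w x * clan_size x e) \<le> (2 * q - 1) * sum w M"
      if "\<And>x. x \<in> M \<Longrightarrow> 0 < w x" for w
      using exists_balanced_clan_embedding[of k w] that assms(3-5)
      unfolding E_def q_def n_def by blast
  qed (use assms(3-) \<open>n \<ge> 1\<close> \<open>q \<ge> 1\<close> nonneg_size in \<open>auto simp: E_def\<close>)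
  obtain S where S: "finite S" "card S = T" "S \<subseteq> ultrametric_clan_embeddings M d (16 * real k)"
    "\<And>x. (\<Sum>s\<in>S. clan_size x s) = (\<Sum>i<T. clan_size x (e i))"
    by (rule exists_set_of_clan_embeddings[of M e d "16 * real k" T]) (use assms(4) eE in \<open>auto simp: E_def\<close>)
  have "S \<noteq> {}" using S(2) \<open>T \<ge> 1\<close> by auto
  have "measure_pmf.expectation (pmf_of_set S) (clan_size x)
      \<le> 2 * n * q * ln n / (\<eta> * T) + (2 * q - 1) * (1 + \<eta>)" if "x \<in> M" for x
  proof -
    have "real T * (2 * q - 1) * (exp \<eta> - 1) \<le> real T * (2 * q - 1) * (\<eta> * (1 + \<eta>))"
      using exp_le_one_plus_quadratic[of \<eta>] assms(7,8) \<open>q \<ge> 1\<close> by (intro mult_left_mono) auto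
    then have "\<eta> * (\<Sum>i<T. clan_size x (e i)) \<le> 2 * n * q * ln n + T * (2 * q - 1) * (\<eta> * (1 + \<eta>))"
      using bound[OF that, of T] by (simp add: n_def)
    then have "(\<Sum>i<T. clan_size x (e i)) / T \<le> 2 * n * q * ln n / (\<eta> * T) + (2 * q - 1) * (1 + \<eta>)"
      using \<open>T \<ge> 1\<close> \<open>0 < \<eta>\<close> by (simp add: field_simps)
    then show ?thesis
      using S \<open>S \<noteq> {}\<close> by (simp add: integral_pmf_of_set)
  qed
  then show thesis using that S \<open>S \<noteq> {}\<close> by blast
qed

text \<open>The added one keeps the number of rounds positive when \<open>x = 0\<close>, as happens
  for a one-point space.\<close>

lemma nat_ceiling_plus_one_bounds:
  fixes x :: real
  assumes "0 \<le> x"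
  shows "x \<le> nat \<lceil>x\<rceil> + 1" "real (nat \<lceil>x\<rceil> + 1) \<le> x + 2"
  using assms by linarith+

text \<open>The distortion factor multiplies \<open>d x x = 0\<close>. This settles
  \<open>n = 1\<close>, where \<open>ln n = 0\<close> makes the claimed factor 0.\<close>

lemma ultrametric_clan_embeddings_singleton:
  assumes "Metric_space {x} d"
  shows "ultrametric_clan_embeddings {x} d s = ultrametric_clan_embeddings {x} d t"
proof -
  interpret Metric_space "{x}" d by fact
  have "d x x = 0" by simp
  then show ?thesis
    unfolding ultrametric_clan_embeddings_def clan_distortion_def by simp
qed

section \<open>Choice of parameters for the two bounds\<close>

text \<open>Taking \<open>k\<close> near \<open>16 * ln (2 * n) / \<epsilon>\<close> gives
  \<open>q \<le> 1 + \<epsilon> / 8\<close>. With \<open>\<eta> = \<epsilon> / 8\<close> and about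
  \<open>64 * n * ln n / \<epsilon>\<^sup>2\<close> rounds, the two summands of the expectation are
  at most \<open>\<epsilon> / 2\<close> and \<open>1 + \<epsilon> / 2\<close>. Rounding
  \<open>T\<close> raises 64 to 66.\<close>

lemma (in Metric_space) uniform_clan_embeddings_close_to_one:
  fixes \<epsilon> :: real
  defines "n \<equiv> real (card M)"
  assumes "finite M" "M \<noteq> {}" "0 < \<epsilon>" "\<epsilon> \<le> 1"
  shows "\<exists>S. finite S \<and> S \<noteq> {} \<and> real (card S) \<le> 66 * max 1 (n * ln n / \<epsilon>\<^sup>2) \<and>
           S \<subseteq> ultrametric_clan_embeddings M d (544 * (ln n / \<epsilon>)) \<and>
           (\<forall>x\<in>M. measure_pmf.expectation (pmf_of_set S) (clan_size x) \<le> 1 + \<epsilon>)"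
proof -
  have "n \<ge> 1" using assms(2,3) by (simp add: n_def Suc_le_eq card_gt_0_iff)
  define k where "k = nat \<lceil>16 * ln (2 * n) / \<epsilon>\<rceil>"
  define T where "T = nat \<lceil>64 * (n * ln n / \<epsilon>\<^sup>2)\<rceil> + 1"
  define q where "q = (2 * n) powr (1 / real k)"
  have "0 < ln (2 * n)" using \<open>n \<ge> 1\<close> by simp
  then have "0 < 16 * ln (2 * n) / \<epsilon>" using \<open>0 < \<epsilon>\<close> by simp
  then have k: "16 * ln (2 * n) / \<epsilon> \<le> k" "k \<le> 16 * ln (2 * n) / \<epsilon> + 1" "k \<ge> 1"
    unfolding k_def by linarith+
  have B: "0 \<le> n * ln n / \<epsilon>\<^sup>2" using \<open>n \<ge> 1\<close> by simp
  then have T: "64 * (n * ln n / \<epsilon>\<^sup>2) \<le> T" "T \<le> 64 * (n * ln n / \<epsilon>\<^sup>2) + 2" "T \<ge> 1"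
    unfolding T_def using nat_ceiling_plus_one_bounds[of "64 * (n * ln n / \<epsilon>\<^sup>2)"] by auto
  have "ln (2 * n) / k \<le> \<epsilon> / 16"
    using k \<open>0 < \<epsilon>\<close> by (simp add: field_simps)
  moreover have "q = exp (ln (2 * n) / k)" using \<open>n \<ge> 1\<close> by (simp add: q_def powr_def)
  ultimately have "q \<le> exp (\<epsilon> / 16)" by simp
  also have "\<dots> \<le> 1 + \<epsilon> / 16 * (1 + \<epsilon> / 16)"
    using exp_le_one_plus_quadratic[of "\<epsilon> / 16"] assms(4,5) by simp
  also have "\<dots> \<le> 1 + \<epsilon> / 16 * 2" using assms(4,5) by (intro add_left_mono mult_left_mono) auto
  finally have q: "q \<le> 1 + \<epsilon> / 8" by simp
  obtain S where S: "finite S" "S \<noteq> {}" "card S = T" "S \<subseteq> ultrametric_clan_embeddings M d (16 * real k)"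
    and exp_S: "\<And>x. x \<in> M \<Longrightarrow> measure_pmf.expectation (pmf_of_set S) (clan_size x)
            \<le> 2 * n * q * ln n / (\<epsilon> / 8 * T) + (2 * q - 1) * (1 + \<epsilon> / 8)"
    by (rule exists_uniform_clan_embeddings[of k T "\<epsilon> / 8"])
      (use assms(2-5) k T in \<open>auto simp: q_def n_def\<close>)
  have "2 * n * q * ln n / (\<epsilon> / 8 * T) \<le> \<epsilon> / 2"
  proof -
    have "32 * n * q * ln n \<le> 32 * n * 2 * ln n"
      using q assms(5) \<open>n \<ge> 1\<close> by (intro mult_right_mono mult_left_mono) auto
    also have "\<dots> \<le> \<epsilon>\<^sup>2 * T" using T(1) \<open>0 < \<epsilon>\<close> by (simp add: field_simps)
    finally show ?thesis
      using \<open>0 < \<epsilon>\<close> T(3) by (simp add: field_simps power2_eq_square)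
  qed
  moreover have "(2 * q - 1) * (1 + \<epsilon> / 8) \<le> 1 + \<epsilon> / 2"
  proof -
    have "(2 * q - 1) * (1 + \<epsilon> / 8) \<le> (1 + \<epsilon> / 4) * (1 + \<epsilon> / 8)"
      using q assms(4) by (intro mult_right_mono) auto
    also have "\<dots> = 1 + \<epsilon> * (3 / 8 + \<epsilon> / 32)" by (simp add: algebra_simps)
    also have "\<dots> \<le> 1 + \<epsilon> * (1 / 2)" using assms(4,5) by (intro add_left_mono mult_left_mono) auto
    finally show ?thesis by simp
  qed
  ultimately have exp_le: "\<forall>x\<in>M. measure_pmf.expectation (pmf_of_set S) (clan_size x) \<le> 1 + \<epsilon>"
    using exp_S by force
  have "S \<subseteq> ultrametric_clan_embeddings M d (544 * (ln n / \<epsilon>))"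
  proof (cases "card M = 1")
    case True
    then obtain x where "M = {x}" by (auto simp: card_1_singleton_iff)
    then show ?thesis
      using S(4) ultrametric_clan_embeddings_singleton[of x d] Metric_space_axioms by metis
  next
    case False
    then have "card M \<ge> 2"
      using \<open>n \<ge> 1\<close> unfolding n_def by (metis One_nat_def Suc_1 Suc_leI le_neq_implies_less of_nat_1 of_nat_le_iff)
    then have "n \<ge> 2" by (simp add: n_def)
    then have ln: "ln 2 \<le> ln n" by simp
    \<comment> \<open>From \<open>ln (1 + u) \<le> u\<close> at \<open>u = -1/2\<close>. It gives
      \<open>1 \<le> 2 * (ln n / \<epsilon>)\<close>, which absorbs the rounding of \<open>k\<close>
      and explains \<open>544 = 16 * (32 + 2)\<close>.\<close>
    have "1 / 2 \<le> ln (2::real)"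
      using ln_add_one_self_le_self2[of "-(1/2)"] by (simp add: ln_div)
    have "ln (2 * n) \<le> 2 * ln n" using ln \<open>n \<ge> 2\<close> by (simp add: ln_mult)
    then have "16 * ln (2 * n) / \<epsilon> \<le> 32 * (ln n / \<epsilon>)"
      using \<open>0 < \<epsilon>\<close> by (simp add: field_simps)
    moreover have "1 \<le> 2 * (ln n / \<epsilon>)"
      using \<open>1 / 2 \<le> ln 2\<close> ln assms(4,5) by (simp add: field_simps)
    ultimately have le: "16 * real k \<le> 544 * (ln n / \<epsilon>)" using k(2) by linarith
    have mono: "ultrametric_clan_embeddings M d (16 * real k) \<subseteq> ultrametric_clan_embeddings M d (544 * (ln n / \<epsilon>))"
      unfolding ultrametric_clan_embeddings_def clan_distortion_def
      using mult_right_mono[OF le nonneg] order_trans by blast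
    then show ?thesis using S(4) by blast
  qed
  moreover have "real (card S) \<le> 66 * max 1 (n * ln n / \<epsilon>\<^sup>2)"
    using T(2) S(3) by (simp add: max_def; linarith)
  ultimately show ?thesis using S exp_le by blast
qed

text \<open>With \<open>\<eta> = 1\<close> and about \<open>n * ln n\<close> rounds the two summands
  are at most \<open>2 * q\<close> and \<open>4 * q\<close>, and
  \<open>q \<le> 2 * n powr (1 / k)\<close> because \<open>2 powr (1 / k) \<le> 2\<close>. This
  gives the constant 12.\<close>

lemma (in Metric_space) uniform_clan_embeddings_fixed_distortion:
  fixes k :: nat
  defines "n \<equiv> real (card M)"
  assumes "finite M" "M \<noteq> {}" "k \<ge> 1"
  shows "\<exists>S. finite S \<and> S \<noteq> {} \<and> real (card S) \<le> 3 * max 1 (n powr (1 + 2 / real k) * ln n) \<and>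
           S \<subseteq> ultrametric_clan_embeddings M d (16 * real k) \<and>
           (\<forall>x\<in>M. measure_pmf.expectation (pmf_of_set S) (clan_size x) \<le> 12 * n powr (1 / real k))"
proof -
  have "n \<ge> 1" using assms(2,3) by (simp add: n_def Suc_le_eq card_gt_0_iff)
  define T where "T = nat \<lceil>n * ln n\<rceil> + 1"
  define q where "q = (2 * n) powr (1 / real k)"
  have T: "n * ln n \<le> T" "T \<le> n * ln n + 2" "T \<ge> 1"
    unfolding T_def using nat_ceiling_plus_one_bounds[of "n * ln n"] \<open>n \<ge> 1\<close> by auto
  have "(2::real) powr (1 / real k) \<le> 2 powr 1" using assms(4) by (intro powr_mono) auto
  then have q: "q \<le> 2 * n powr (1 / real k)"
    using \<open>n \<ge> 1\<close> by (simp add: q_def powr_mult mult_right_mono)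
  have "q \<ge> 0" by (simp add: q_def)
  obtain S where S: "finite S" "S \<noteq> {}" "card S = T" "S \<subseteq> ultrametric_clan_embeddings M d (16 * real k)"
    and exp_S: "\<And>x. x \<in> M \<Longrightarrow> measure_pmf.expectation (pmf_of_set S) (clan_size x)
            \<le> 2 * n * q * ln n / (1 * T) + (2 * q - 1) * (1 + 1)"
    by (rule exists_uniform_clan_embeddings[of k T 1])
      (use assms(2-4) T in \<open>auto simp: q_def n_def\<close>)
  have "2 * n * q * ln n = 2 * q * (n * ln n)" by simp
  also have "\<dots> \<le> 2 * q * T" using T(1) \<open>q \<ge> 0\<close> by (intro mult_left_mono) auto
  finally have "2 * n * q * ln n / (1 * T) \<le> 2 * q" using T(3) by (simp add: field_simps)
  then have "measure_pmf.expectation (pmf_of_set S) (clan_size x) \<le> 12 * n powr (1 / real k)"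
    if "x \<in> M" for x
    using exp_S[OF that] q by (simp add: algebra_simps)
  moreover have "n * ln n \<le> n powr (1 + 2 / real k) * ln n"
    using \<open>n \<ge> 1\<close> powr_mono[of 1 "1 + 2 / real k" n] by (intro mult_right_mono) auto
  then have "real (card S) \<le> 3 * max 1 (n powr (1 + 2 / real k) * ln n)"
    using T(2) S(3) by (simp add: max_def; linarith)
  ultimately show ?thesis using S by blast
qed

theorem theorem1:
  shows
    "(\<exists>C D :: real. \<forall>(X :: 'a set) d n \<epsilon>.
        Metric_space X d \<and> finite X \<and> X \<noteq> {} \<and> n = card X \<and> 0 < \<epsilon> \<and> \<epsilon> \<le> 1 \<longrightarrow>
        (\<exists>S. finite S \<and> S \<noteq> {} \<and>
           real (card S) \<le> C * max 1 (real n * ln (real n) / \<epsilon>\<^sup>2) \<and>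
           S \<subseteq> ultrametric_clan_embeddings X d (D * (ln (real n) / \<epsilon>)) \<and>
           (\<forall>x\<in>X. measure_pmf.expectation (pmf_of_set S) (clan_size x) \<le> 1 + \<epsilon>)))
     \<and>
     (\<exists>C D :: real. \<forall>(X :: 'a set) d n (k :: nat).
        Metric_space X d \<and> finite X \<and> X \<noteq> {} \<and> n = card X \<and> k \<ge> 1 \<longrightarrow>
        (\<exists>S. finite S \<and> S \<noteq> {} \<and>
           real (card S) \<le> C * max 1 (real n powr (1 + 2 / real k) * ln (real n)) \<and>
           S \<subseteq> ultrametric_clan_embeddings X d (16 * real k) \<and>
           (\<forall>x\<in>X. measure_pmf.expectation (pmf_of_set S) (clan_size x)
                     \<le> D * real n powr (1 / real k))))"
proof (rule conjI)
  show "\<exists>C D :: real. \<forall>(X :: 'a set) d n \<epsilon>.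
      Metric_space X d \<and> finite X \<and> X \<noteq> {} \<and> n = card X \<and> 0 < \<epsilon> \<and> \<epsilon> \<le> 1 \<longrightarrow>
      (\<exists>S. finite S \<and> S \<noteq> {} \<and>
         real (card S) \<le> C * max 1 (real n * ln (real n) / \<epsilon>\<^sup>2) \<and>
         S \<subseteq> ultrametric_clan_embeddings X d (D * (ln (real n) / \<epsilon>)) \<and>
         (\<forall>x\<in>X. measure_pmf.expectation (pmf_of_set S) (clan_size x) \<le> 1 + \<epsilon>))"
    by (intro exI[of _ 66] exI[of _ 544] allI impI, elim conjE, hypsubst)
      (rule Metric_space.uniform_clan_embeddings_close_to_one)
  show "\<exists>C D :: real. \<forall>(X :: 'a set) d n (k :: nat).
      Metric_space X d \<and> finite X \<and> X \<noteq> {} \<and> n = card X \<and> k \<ge> 1 \<longrightarrow>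
      (\<exists>S. finite S \<and> S \<noteq> {} \<and>
         real (card S) \<le> C * max 1 (real n powr (1 + 2 / real k) * ln (real n)) \<and>
         S \<subseteq> ultrametric_clan_embeddings X d (16 * real k) \<and>
         (\<forall>x\<in>X. measure_pmf.expectation (pmf_of_set S) (clan_size x)
                   \<le> D * real n powr (1 / real k)))"
    by (intro exI[of _ 3] exI[of _ 12] allI impI, elim conjE, hypsubst)
      (rule Metric_space.uniform_clan_embeddings_fixed_distortion)
qed

end
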